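(* Let $\Gamma$ be a finite simple graph whose edges are each colored with exactly one of the colors red, green, blue, and let $R$, $G$, $B$ be the numbers of red, green and blue edges, respectively. If $\Gamma$ has exactly $\sqrt{2RGB} > 0$ rainbow triangles, then $\Gamma$ is obtained from a blowup of a properly $3$-edge-colored $K_4$ by possibly adding a set of isolated vertices.
   Context: A rainbow triangle is a triangle of $\Gamma$ whose three edges have three distinct colors. A properly $3$-edge-colored $K_4$ is the complete graph on four vertices with its edges colored by the three colors so that each color class is a perfect matching (opposite edges get the same color). A blowup of it is obtained by replacing each vertex of this $K_4$ by a nonempty independent set of vertices and each edge of color $c$ by a complete bipartite graph between the corresponding two sets, all of whose edges have color $c$. *)

theory Defs
  imports Complex_Main "HOL-Library.Ramsey" "HOL-Library.Disjoint_Sets"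
begin

text \<open>
  Graphs are given by a vertex set \<open>V\<close> and a set \<open>E\<close> of edges, each edge being a two-element set;
  \<open>[V]\<^bsup>2\<^esup>\<close> is the set of all two-element subsets of \<open>V\<close>. A coloring is a total function
  on sets of vertices of which only the values on \<open>E\<close> matter.
\<close>

datatype color = Red | Green | Blue

definition finite_simple_graph :: "'a set \<Rightarrow> 'a set set \<Rightarrow> bool" where
  "finite_simple_graph V E \<longleftrightarrow> finite V \<and> E \<subseteq> [V]\<^bsup>2\<^esup>"

definition color_class :: "'a set set \<Rightarrow> ('a set \<Rightarrow> color) \<Rightarrow> color \<Rightarrow> 'a set set" where
  "color_class E c k = {e \<in> E. c e = k}"

text \<open>A triangle is identified with its three-element vertex set \<open>T\<close>; its edges are \<open>[T]\<^bsup>2\<^esup>\<close>.\<close>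

definition triangles :: "'a set \<Rightarrow> 'a set set \<Rightarrow> 'a set set" where
  "triangles V E = {T \<in> [V]\<^bsup>3\<^esup>. [T]\<^bsup>2\<^esup> \<subseteq> E}"

definition rainbow_triangles :: "'a set \<Rightarrow> 'a set set \<Rightarrow> ('a set \<Rightarrow> color) \<Rightarrow> 'a set set" where
  "rainbow_triangles V E c = {T \<in> triangles V E. inj_on c ([T]\<^bsup>2\<^esup>)}"

definition perfect_matching :: "'a set \<Rightarrow> 'a set set \<Rightarrow> bool" where
  "perfect_matching V M \<longleftrightarrow> M \<subseteq> [V]\<^bsup>2\<^esup> \<and> (\<forall>v\<in>V. \<exists>!e. e \<in> M \<and> v \<in> e)"

definition properly_colored_K4 :: "'a set \<Rightarrow> 'a set set \<Rightarrow> ('a set \<Rightarrow> color) \<Rightarrow> bool" where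
  "properly_colored_K4 W F d \<longleftrightarrow>
     card W = 4 \<and> F = [W]\<^bsup>2\<^esup> \<and> (\<forall>k. perfect_matching W (color_class F d k))"

text \<open>
  \<open>P x\<close> is the vertex set replacing the vertex \<open>x\<close>. It is independent because \<open>F\<close> contains no
  singletons and the sets \<open>P x\<close> are disjoint.
\<close>

definition is_blowup ::
  "'a set \<Rightarrow> 'a set set \<Rightarrow> ('a set \<Rightarrow> color) \<Rightarrow> 'b set \<Rightarrow> 'b set set \<Rightarrow> ('b set \<Rightarrow> color) \<Rightarrow> bool" where
  "is_blowup V E c W F d \<longleftrightarrow>
     (\<exists>P. (\<forall>x\<in>W. P x \<noteq> {}) \<and> disjoint_family_on P W \<and> V = (\<Union>x\<in>W. P x) \<and>
          E = {{u, v} | u v x y. x \<in> W \<and> y \<in> W \<and> {x, y} \<in> F \<and> u \<in> P x \<and> v \<in> P y} \<and>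
          (\<forall>x\<in>W. \<forall>y\<in>W. {x, y} \<in> F \<longrightarrow> (\<forall>u\<in>P x. \<forall>v\<in>P y. c {u, v} = d {x, y})))"

text \<open>
  The four vertices of the \<open>K\<^sub>4\<close> are taken to be natural numbers; up to isomorphism this is no
  restriction.
\<close>

definition is_blowup_of_K4 :: "'a set \<Rightarrow> 'a set set \<Rightarrow> ('a set \<Rightarrow> color) \<Rightarrow> bool" where
  "is_blowup_of_K4 V E c \<longleftrightarrow>
     (\<exists>(W :: nat set) F d. properly_colored_K4 W F d \<and> is_blowup V E c W F d)"

end

(*
  Let K, L, M be the numbers of edges of the three colors k, l, m, let T be the number of rainbow
  triangles, and let n(x, y) be the number of z such that xz has color k and zy has color l. Summed
  over the ordered pairs (x, y) of color m it counts every rainbow triangle once. By Cauchy-Schwarz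
  T^2 <= 2 M * (sum of n^2), and the sum of n^2 is at most K L, because the quadruples (x, y, z, w)
  with z and w both counted by n(x, y) are determined by the edges {x, z} and {y, w}. In the case
  of equality n is a positive constant and every pair of a k-edge and an l-edge arises in this
  way, for every ordering k, l, m of the colors. Consequently every edge xy of color m has, in both
  orientations, a common neighbor z as above, and two edges vu, vu' of distinct colors span a
  rainbow triangle. The second fact gives N_l(u) = N_m(v) whenever uv has color k, which makes
  every nontrivial component a blowup of K_4; as every green edge is joined to every blue edge,
  there is only one such component.
*)
theory Submission
  imports Defs
begin

section \<open>Colored adjacency in a finite graph\<close>

locale colored_graph =
  fixes V :: "'a set" and E :: "'a set set" and c :: "'a set \<Rightarrow> color"
  assumes simple: "finite_simple_graph V E"
begin

definition adj :: "color \<Rightarrow> 'a \<Rightarrow> 'a \<Rightarrow> bool" where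
  "adj k x y \<longleftrightarrow> {x, y} \<in> E \<and> c {x, y} = k"

definition nb :: "color \<Rightarrow> 'a \<Rightarrow> 'a set" where
  "nb k x = {y. adj k x y}"

definition arcs :: "color \<Rightarrow> ('a \<times> 'a) set" where
  "arcs k = {(x, y). adj k x y}"

lemma finite_V: "finite V"
  using simple by (simp add: finite_simple_graph_def)

lemma edgeE:
  assumes "e \<in> E"
  obtains x y where "e = {x, y}" "x \<noteq> y" "x \<in> V" "y \<in> V"
  using assms simple
  by (fastforce simp: finite_simple_graph_def nsets_def card_2_iff)

lemma finite_E: "finite E"
  by (rule finite_subset[of _ "Pow V"]) (auto simp: finite_V elim: edgeE)

lemma finite_color_class: "finite (color_class E c k)"
  using finite_E by (simp add: color_class_def)

lemma adj_sym: "adj k x y \<longleftrightarrow> adj k y x"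
  by (simp add: adj_def insert_commute)

lemma adj_irrefl: "\<not> adj k x x"
  unfolding adj_def by (auto elim: edgeE)

lemma adj_unique: "adj k x y \<Longrightarrow> adj l x y \<Longrightarrow> k = l"
  by (auto simp: adj_def)

lemma adj_V: "adj k x y \<Longrightarrow> x \<in> V \<and> y \<in> V"
  unfolding adj_def by (metis edgeE insert_iff singletonD)

lemma color_class_adj: "{x, y} \<in> color_class E c k \<longleftrightarrow> adj k x y"
  by (simp add: color_class_def adj_def)

lemma finite_arcs: "finite (arcs k)"
  by (rule finite_subset[of _ "V \<times> V"]) (auto simp: arcs_def finite_V dest: adj_V)

lemma finite_nb: "finite (nb k x)"
  by (rule finite_subset[OF _ finite_V]) (auto simp: nb_def dest: adj_V)

lemma card_arcs: "card (arcs k) = 2 * card (color_class E c k)"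
proof -
  have "arcs k = (\<Union>e\<in>color_class E c k. {(x, y). {x, y} = e})"
    by (auto simp: arcs_def color_class_def adj_def)
  also have "card \<dots> = (\<Sum>e\<in>color_class E c k. card {(x, y). {x, y} = e})"
  proof (rule card_UN_disjoint[OF finite_color_class])
    show "\<forall>e\<in>color_class E c k. finite {(x, y). {x, y} = e}"
    proof
      fix e assume "e \<in> color_class E c k"
      then have "e \<in> E" by (simp add: color_class_def)
      then have "finite (e \<times> e)" by (auto elim: edgeE)
      then show "finite {(x, y). {x, y} = e}"
        by (rule finite_subset[rotated]) auto
    qed
  qed auto
  also have "\<dots> = (\<Sum>e\<in>color_class E c k. 2)"
  proof (rule sum.cong[OF refl])
    fix e assume "e \<in> color_class E c k"
    then obtain x y where "e = {x, y}" "x \<noteq> y"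
      by (auto simp: color_class_def elim: edgeE)
    moreover from this have "{(a, b). {a, b} = e} = {(x, y), (y, x)}"
      by (auto simp: doubleton_eq_iff)
    ultimately show "card {(a, b). {a, b} = e} = 2" by simp
  qed
  finally show ?thesis by simp
qed

section \<open>Counting rainbow triangles, and pairs of them over a common edge\<close>

lemma nsets_3_2:
  assumes "x \<noteq> y" "x \<noteq> z" "y \<noteq> z"
  shows "[{x, y, z}]\<^bsup>2\<^esup> = {{x, y}, {x, z}, {z, y}}"
  using assms by (fastforce simp: nsets_def card_2_iff insert_commute)

text \<open>The \<open>m\<close>-edge is oriented so that its first end \<open>x\<close> meets the
  \<open>k\<close>-edge; for distinct colors this leaves one labelling per triangle.\<close>

definition rainbow_paths :: "color \<Rightarrow> color \<Rightarrow> color \<Rightarrow> (('a \<times> 'a) \<times> 'a) set" where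
  "rainbow_paths k l m = Sigma (arcs m) (\<lambda>(x, y). nb k x \<inter> nb l y)"

text \<open>The colors name the vertices of a rainbow triangle: \<open>x\<close> avoids the
  \<open>l\<close>-edge, \<open>y\<close> the \<open>k\<close>-edge and \<open>z\<close> the
  \<open>m\<close>-edge.\<close>

lemma card_rainbow_triangles:
  assumes dist: "distinct [k, l, m]"
  shows "card (rainbow_triangles V E c) = card (rainbow_paths k l m)"
proof -
  let ?f = "\<lambda>((x, y), z). {x, y, z}"
  have cols: "i = k \<or> i = l \<or> i = m" for i
    using dist by (cases i; cases k; cases l; cases m; simp)
  have "bij_betw ?f (rainbow_paths k l m) (rainbow_triangles V E c)"
  proof (rule bij_betw_imageI)
    show "inj_on ?f (rainbow_paths k l m)"
    proof (rule inj_onI)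
      fix p p' assume pp: "p \<in> rainbow_paths k l m" "p' \<in> rainbow_paths k l m" "?f p = ?f p'"
      obtain x y z x' y' z' where p: "p = ((x, y), z)" "p' = ((x', y'), z')"
        by (metis surj_pair)
      have eq: "{x, y, z} = {x', y', z'}"
        using pp(3) by (simp add: p)
      have A: "adj m x y" "adj k x z" "adj l y z" "adj m x' y'" "adj k x' z'" "adj l y' z'"
        using pp(1,2) by (auto simp: p rainbow_paths_def arcs_def nb_def)
      then have "x \<noteq> y" "x \<noteq> z" "y \<noteq> z" "x' \<noteq> y'" "x' \<noteq> z'" "y' \<noteq> z'"
        by (auto simp: adj_irrefl)
      moreover have "x' \<in> {x, y, z}" "y' \<in> {x, y, z}" "z' \<in> {x, y, z}"
        using eq by auto
      moreover have "\<not> adj m x z" "\<not> adj m y z" "\<not> adj k x y" "\<not> adj k y z" "\<not> adj l x y" "\<not> adj l x z"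
        using A dist by (auto dest: adj_unique)
      ultimately show "p = p'"
        using A(4-6) by (auto simp: p adj_sym)
    qed
    show "?f ` rainbow_paths k l m = rainbow_triangles V E c"
    proof (intro equalityI subsetI)
      fix T assume "T \<in> ?f ` rainbow_paths k l m"
      then obtain x y z where T: "T = {x, y, z}" and A: "adj m x y" "adj k x z" "adj l z y"
        by (auto simp: rainbow_paths_def arcs_def nb_def adj_sym)
      have n: "x \<noteq> y" "x \<noteq> z" "y \<noteq> z"
        using A by (auto simp: adj_irrefl)
      have "inj_on c {{x, y}, {x, z}, {z, y}}"
        using A dist by (auto simp: inj_on_def adj_def)
      then show "T \<in> rainbow_triangles V E c"
        using T n A nsets_3_2[OF n] adj_V
        by (auto simp: rainbow_triangles_def triangles_def nsets_def[of V 3] adj_def)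
    next
      fix T assume "T \<in> rainbow_triangles V E c"
      then have "card T = 3" and sub: "[T]\<^bsup>2\<^esup> \<subseteq> E" and inj: "inj_on c ([T]\<^bsup>2\<^esup>)"
        by (auto simp: rainbow_triangles_def triangles_def nsets_def)
      then obtain p q r where T: "T = {p, q, r}" and n: "p \<noteq> q" "p \<noteq> r" "q \<noteq> r"
        by (auto simp: card_3_iff)
      have e: "{p, q} \<noteq> {p, r}" "{p, q} \<noteq> {r, q}" "{p, r} \<noteq> {r, q}"
        using n by (auto simp: doubleton_eq_iff)
      obtain i j h where A: "adj i p q" "adj j p r" "adj h r q"
        using sub unfolding T nsets_3_2[OF n] adj_def by auto
      have d: "i \<noteq> j" "i \<noteq> h" "j \<noteq> h"
        using inj A e unfolding T nsets_3_2[OF n] adj_def by (auto simp: inj_on_def)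
      have sym: "adj i q p" "adj j r p" "adj h q r"
        using A by (auto simp: adj_sym)
      have mem: "{x, y, z} = T \<Longrightarrow> adj m x y \<Longrightarrow> adj k x z \<Longrightarrow> adj l y z
          \<Longrightarrow> T \<in> ?f ` rainbow_paths k l m" for x y z
        by (rule image_eqI[of _ _ "((x, y), z)"])
          (auto simp: rainbow_paths_def arcs_def nb_def)
      \<comment> \<open>Each of the six orders of the colors on \<open>pq\<close>,
        \<open>pr\<close>, \<open>rq\<close> is served by one of the six instances of
        \<open>mem\<close>.\<close>
      have "(i = m \<and> j = k \<and> h = l) \<or> (i = m \<and> j = l \<and> h = k) \<or> (i = k \<and> j = m \<and> h = l) \<or>
        (i = l \<and> j = m \<and> h = k) \<or> (i = k \<and> j = l \<and> h = m) \<or> (i = l \<and> j = k \<and> h = m)"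
        using cols[of i] cols[of j] cols[of h] d by auto
      then show "T \<in> ?f ` rainbow_paths k l m"
        using mem[of p q r] mem[of q p r] mem[of p r q] mem[of r p q] mem[of q r p] mem[of r q p]
          A sym T by (elim disjE) (auto simp: insert_commute)
    qed
  qed
  then show ?thesis by (simp add: bij_betw_same_card)
qed

text \<open>Since \<open>z = w\<close> is allowed, the cardinality is a sum of squares over the
  \<open>m\<close>-arcs, as Cauchy-Schwarz needs.\<close>

definition double_paths :: "color \<Rightarrow> color \<Rightarrow> color \<Rightarrow> (('a \<times> 'a) \<times> ('a \<times> 'a)) set" where
  "double_paths k l m = Sigma (arcs m) (\<lambda>(x, y). (nb k x \<inter> nb l y) \<times> (nb k x \<inter> nb l y))"

text \<open>
  A \<open>k\<close>-edge \<open>{u, v}\<close> and an \<open>l\<close>-edge \<open>{p, q}\<close> determine which of their ends are \<open>x\<close> and \<open>y\<close>: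
  with \<open>x = u\<close>, \<open>y = p\<close> the pairs \<open>up\<close>, \<open>uq\<close>, \<open>vp\<close> have colors \<open>m\<close>, \<open>k\<close>, \<open>l\<close>, and the three other
  choices contradict this.
\<close>
lemma double_paths_inj:
  assumes dist: "distinct [k, l, m]"
  shows "inj_on (\<lambda>((x, y), (z, w)). ({x, z}, {y, w})) (double_paths k l m)"
    (is "inj_on ?f _")
proof (rule inj_onI)
  fix p p' assume pp: "p \<in> double_paths k l m" "p' \<in> double_paths k l m" "?f p = ?f p'"
  obtain x y z w x' y' z' w' where p: "p = ((x, y), (z, w))" "p' = ((x', y'), (z', w'))"
    by (metis surj_pair)
  have eq: "{x, z} = {x', z'}" "{y, w} = {y', w'}"
    using pp(3) by (simp_all add: p)
  have A: "adj m x y" "adj k x z" "adj l y z" "adj k x w" "adj l y w"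
    and A': "adj m x' y'" "adj k x' z'" "adj l y' z'" "adj k x' w'" "adj l y' w'"
    using pp(1,2) by (auto simp: p double_paths_def arcs_def nb_def)
  have d: "\<not> adj m x w" "\<not> adj m z y" "\<not> (adj m z w \<and> adj k z y)"
    using A dist by (auto dest: adj_unique simp: adj_sym)
  show "p = p'"
    using eq d A' A unfolding p doubleton_eq_iff by auto
qed

lemma double_paths_image:
  "(\<lambda>((x, y), (z, w)). ({x, z}, {y, w})) ` double_paths k l m
    \<subseteq> color_class E c k \<times> color_class E c l"
  by (auto simp: double_paths_def nb_def color_class_adj)

end

text \<open>The defect in Cauchy-Schwarz as a sum of squares: if it vanishes for finite
  \<open>A\<close>, then \<open>f\<close> is constant on \<open>A\<close>. Scaling by
  \<open>card A\<close> avoids dividing to form the mean.\<close>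

lemma sum_squares_deviation:
  fixes f :: "'b \<Rightarrow> real"
  shows "(\<Sum>x\<in>A. (real (card A) * f x - sum f A)\<^sup>2)
    = real (card A) * (real (card A) * (\<Sum>x\<in>A. (f x)\<^sup>2) - (sum f A)\<^sup>2)"
proof -
  have "(\<Sum>x\<in>A. (real (card A) * f x - sum f A)\<^sup>2)
      = (\<Sum>x\<in>A. (real (card A))\<^sup>2 * (f x)\<^sup>2 - 2 * real (card A) * sum f A * f x + (sum f A)\<^sup>2)"
    by (intro sum.cong refl) (simp add: power2_eq_square algebra_simps)
  also have "\<dots> = (real (card A))\<^sup>2 * (\<Sum>x\<in>A. (f x)\<^sup>2) - 2 * real (card A) * sum f A * sum f A
      + real (card A) * (sum f A)\<^sup>2"
    by (simp add: sum.distrib sum_subtractf flip: sum_distrib_left)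
  finally show ?thesis by (simp add: power2_eq_square algebra_simps)
qed

section \<open>The properly colored complete graph in coordinates\<close>

text \<open>The neighbor of \<open>x\<close> along color \<open>k\<close> in the properly colored \<open>K\<^sub>4\<close> on \<open>{0, 1, 2, 3}\<close>.\<close>

definition partner :: "color \<Rightarrow> nat \<Rightarrow> nat" where
  "partner k x = (case k of Red \<Rightarrow> [1, 0, 3, 2] | Green \<Rightarrow> [2, 3, 0, 1] | Blue \<Rightarrow> [3, 2, 1, 0]) ! x"

text \<open>On edges the default \<open>Blue\<close> is reached only by \<open>{0, 3}\<close> and
  \<open>{1, 2}\<close>. In binary, the color of \<open>{x, y}\<close> encodes the exclusive or of
  \<open>x\<close> and \<open>y\<close>.\<close>

definition K4_color :: "nat set \<Rightarrow> color" where
  "K4_color e = (if e \<in> {{0, 1}, {2, 3}} then Red else if e \<in> {{0, 2}, {1, 3}} then Green else Blue)"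

lemma lessThan_4: "{..<4} = {0, 1, 2, 3 :: nat}"
  by auto

lemma partner_less: "x \<in> {..<4} \<Longrightarrow> partner k x \<in> {..<4}"
  by (cases k) (auto simp: partner_def lessThan_4)

lemma partner_neq: "x \<in> {..<4} \<Longrightarrow> partner k x \<noteq> x"
  by (cases k) (auto simp: partner_def lessThan_4)

lemma partner_K4_color:
  "x \<in> {..<4} \<Longrightarrow> y \<in> {..<4} \<Longrightarrow> x \<noteq> y \<Longrightarrow> partner (K4_color {x, y}) x = y"
  by (auto simp: partner_def K4_color_def lessThan_4 doubleton_eq_iff)

lemma K4_color_partner: "x \<in> {..<4} \<Longrightarrow> K4_color {x, partner k x} = k"
  by (cases k) (auto simp: partner_def K4_color_def lessThan_4 doubleton_eq_iff)

lemma properly_colored_K4: "properly_colored_K4 {..<4} ([{..<4}]\<^bsup>2\<^esup>) K4_color"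
proof -
  have "\<exists>!e. e \<in> color_class ([{..<4}]\<^bsup>2\<^esup>) K4_color k \<and> x \<in> e" if x: "x \<in> {..<4}" for k x
  proof (rule ex1I[of _ "{x, partner k x}"])
    show "{x, partner k x} \<in> color_class ([{..<4}]\<^bsup>2\<^esup>) K4_color k \<and> x \<in> {x, partner k x}"
      using x partner_less[OF x, of k] partner_neq[OF x, of k] K4_color_partner[OF x, of k]
      by (auto simp: color_class_def nsets_def)
  next
    fix e assume "e \<in> color_class ([{..<4}]\<^bsup>2\<^esup>) K4_color k \<and> x \<in> e"
    then have e: "e \<subseteq> {..<4}" "card e = 2" "K4_color e = k" "x \<in> e"
      by (auto simp: color_class_def nsets_def)
    then obtain y where y: "e = {x, y}" "x \<noteq> y"
      by (auto simp: card_2_iff)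
    then show "e = {x, partner k x}"
      using partner_K4_color[OF x, of y] e by auto
  qed
  then show ?thesis
    unfolding properly_colored_K4_def perfect_matching_def
    by (auto simp: color_class_def)
qed

section \<open>Consequences of equality in the bound\<close>

locale extremal_graph = colored_graph +
  assumes extremal: "(card (rainbow_triangles V E c))\<^sup>2 =
      2 * card (color_class E c Red) * card (color_class E c Green) * card (color_class E c Blue)"
    and rainbow: "rainbow_triangles V E c \<noteq> {}"
begin

text \<open>By this symmetry, what is shown for one assignment of the roles \<open>k\<close>,
  \<open>l\<close>, \<open>m\<close> holds for all six.\<close>

lemma extremal_perm:
  assumes "distinct [k, l, m]"
  shows "(card (rainbow_triangles V E c))\<^sup>2 =
    2 * card (color_class E c k) * card (color_class E c l) * card (color_class E c m)"
  using extremal assms by (cases k; cases l; cases m; simp add: ac_simps)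

lemma finite_rainbow: "finite (rainbow_triangles V E c)"
  by (rule finite_subset[of _ "Pow V"])
    (auto simp: finite_V rainbow_triangles_def triangles_def nsets_def)

lemma arc_exists: "\<exists>x y. adj k x y"
proof -
  have "card (rainbow_triangles V E c) > 0"
    using rainbow finite_rainbow by (simp add: card_gt_0_iff)
  then have "card (color_class E c k) > 0"
    using extremal by (cases k) (auto intro!: Nat.gr0I)
  then have "arcs k \<noteq> {}"
    using card_arcs[of k] by auto
  then show ?thesis by (auto simp: arcs_def)
qed

text \<open>Equality forces both estimates, Cauchy-Schwarz and the bound on
  \<open>double_paths\<close>, to be sharp.\<close>

lemma equality_cases:
  assumes dist: "distinct [k, l, m]"
  shows "card (double_paths k l m) = card (color_class E c k) * card (color_class E c l)"
    and "adj m x y \<Longrightarrow> \<exists>z. adj k x z \<and> adj l z y"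
proof -
  define n where "n = (\<lambda>(x, y). real (card (nb k x \<inter> nb l y)))"
  define t where "t = real (card (rainbow_triangles V E c))"
  define s where "s = real (card (arcs m))"
  define K where "K = real (card (color_class E c k) * card (color_class E c l))"
  have t0: "t > 0"
    using rainbow finite_rainbow by (simp add: card_gt_0_iff t_def)
  have s0: "s > 0"
    using arc_exists[of m] finite_arcs by (auto simp: s_def card_gt_0_iff arcs_def)
  have sum_n: "sum n (arcs m) = t"
    unfolding t_def card_rainbow_triangles[OF dist] rainbow_paths_def n_def
    by (subst card_SigmaI) (auto simp: finite_arcs finite_nb case_prod_unfold)
  have sum_n2: "(\<Sum>p\<in>arcs m. (n p)\<^sup>2) = card (double_paths k l m)"
    unfolding double_paths_def n_def
    by (subst card_SigmaI)
      (auto simp: finite_arcs finite_nb case_prod_unfold card_cartesian_product power2_eq_square)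
  have le: "card (double_paths k l m) \<le> card (color_class E c k) * card (color_class E c l)"
    using card_inj_on_le[OF double_paths_inj[OF dist] double_paths_image]
    by (simp add: finite_color_class card_cartesian_product)
  \<comment> \<open>As \<open>s\<close> is twice the number of \<open>m\<close>-edges, this is the
    extremal hypothesis.\<close>
  have tt: "t\<^sup>2 = s * K"
    using extremal_perm[OF dist] card_arcs[of m]
    by (simp add: t_def s_def K_def mult_ac flip: of_nat_power of_nat_mult)
  have dev: "(\<Sum>p\<in>arcs m. (s * n p - t)\<^sup>2) = s * (s * (card (double_paths k l m) - K))"
    using sum_squares_deviation[where A = "arcs m" and f = n]
    unfolding sum_n sum_n2 tt s_def[symmetric] by (simp add: algebra_simps)
  \<comment> \<open>The quantity in \<open>dev\<close> is nonnegative as a sum of squares and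
    nonpositive by \<open>le\<close>, so it is zero.\<close>
  have "real (card (double_paths k l m)) - K \<le> 0"
    using le unfolding K_def by linarith
  moreover have "0 \<le> s * (s * (card (double_paths k l m) - K))"
    unfolding dev[symmetric] by (intro sum_nonneg) simp
  ultimately have eq: "card (double_paths k l m) = K"
    using s0 by (simp add: zero_le_mult_iff)
  then show "card (double_paths k l m) = card (color_class E c k) * card (color_class E c l)"
    unfolding K_def of_nat_eq_iff .
  have "(\<Sum>p\<in>arcs m. (s * n p - t)\<^sup>2) = 0"
    using dev eq by simp
  then have "\<forall>p\<in>arcs m. s * n p = t"
    by (subst (asm) sum_nonneg_eq_0_iff) (auto simp: finite_arcs)
  moreover assume "adj m x y"
  ultimately have "s * n (x, y) = t" by (auto simp: arcs_def)
  then have "n (x, y) \<noteq> 0" using t0 by auto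
  then have "nb k x \<inter> nb l y \<noteq> {}" by (auto simp: n_def)
  then show "\<exists>z. adj k x z \<and> adj l z y" by (auto simp: nb_def adj_sym)
qed

text \<open>An injection between finite sets of equal size is onto, so every pair of edges comes
  from a double path.\<close>

lemma edges_linked:
  assumes dist: "distinct [k, l, m]" and "adj k u v" "adj l p q"
  obtains x y z w where "{u, v} = {x, z}" "{p, q} = {y, w}"
    "adj m x y" "adj k x z" "adj l y z" "adj k x w" "adj l y w"
proof -
  let ?f = "\<lambda>((x, y), (z, w)). ({x, z}, {y, w})"
  have "?f ` double_paths k l m = color_class E c k \<times> color_class E c l"
    by (rule card_subset_eq[OF _ double_paths_image])
      (simp_all add: finite_color_class card_image[OF double_paths_inj[OF dist]]
        equality_cases(1)[OF dist] card_cartesian_product)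
  then have "({u, v}, {p, q}) \<in> ?f ` double_paths k l m"
    using assms by (simp add: color_class_adj)
  then show thesis
    by (auto simp: double_paths_def arcs_def nb_def intro: that)
qed

text \<open>The \<open>m\<close>-edge linking \<open>{v, a}\<close> to \<open>{v, b}\<close> cannot
  be a loop at \<open>v\<close>, nor \<open>vb\<close> or \<open>va\<close>, which have other
  colors; only \<open>ab\<close> remains.\<close>

lemma rainbow_cherry:
  assumes dist: "distinct [k, l, m]" and "adj k v a" "adj l v b"
  shows "adj m a b"
proof -
  obtain x y z w where "{v, a} = {x, z}" "{v, b} = {y, w}" "adj m x y"
    using edges_linked[OF assms] by metis
  moreover have "\<not> adj m v b" "\<not> adj m a v"
    using assms by (auto dest: adj_unique simp: adj_sym)
  ultimately show ?thesis
    by (auto simp: doubleton_eq_iff adj_irrefl)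
qed

text \<open>The two inclusions come from the cherries at \<open>u\<close> and at \<open>v\<close>.
  Neighborhoods are thereby transported along edges.\<close>

lemma nb_swap:
  assumes dist: "distinct [k, l, m]" and "adj k v u"
  shows "nb l u = nb m v"
  using rainbow_cherry[of k l m u v] rainbow_cherry[of k m l v u] assms
  by (auto simp: nb_def adj_sym)

text \<open>The edge \<open>vu\<close> lies in a rainbow triangle, in either orientation, so a
  vertex meeting one color meets all three.\<close>

lemma nb_nonempty:
  assumes "adj k v u"
  shows "nb l v \<noteq> {}"
proof (cases "k = l")
  case False
  then obtain m where "distinct [l, m, k]"
    by (cases k; cases l) (auto intro: color.exhaust)
  then show ?thesis
    using equality_cases(2)[of l m k v u] assms by (auto simp: nb_def)
qed (use assms in \<open>auto simp: nb_def\<close>)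

section \<open>Assembling the blowup\<close>

lemma K4_parts:
  obtains P where
    "\<And>x. x \<in> {..<4} \<Longrightarrow> P x \<noteq> {}"
    "\<And>x k u. x \<in> {..<4} \<Longrightarrow> u \<in> P x \<Longrightarrow> nb k u = P (partner k x)"
proof -
  obtain v u where u: "adj Red v u"
    using arc_exists by blast
  obtain w s where w: "adj Green v w" and s: "adj Blue v s"
    using nb_nonempty[OF u] by (fastforce simp: nb_def)
  \<comment> \<open>Part 0 is to contain \<open>v\<close>, and the other parts are its
    neighborhoods; seen from \<open>u\<close>, part 0 is the \<open>Red\<close>
    neighborhood.\<close>
  define P where "P = (!) [nb Red u, nb Red v, nb Green v, nb Blue v]"
  have swap: "nb l y = nb m x" if "y \<in> nb k x" "distinct [k, l, m]" for k l m x y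
    using nb_swap[of k l m x y] that by (simp add: nb_def)
  have sym: "y \<in> nb k x \<longleftrightarrow> x \<in> nb k y" for k x y
    by (simp add: nb_def adj_sym)
  have mem: "u \<in> nb Red v" "w \<in> nb Green v" "s \<in> nb Blue v"
    using u w s by (simp_all add: nb_def)
  have P0: "nb Red u = nb Green w" "nb Red u = nb Blue s"
    using swap[of w Blue u Green Red] swap[of s Green u Blue Red] mem
      swap[OF mem(1), of Blue Green] swap[OF mem(1), of Green Blue] by simp_all
  have "nb k x = P (partner k i)" if "i \<in> {..<4}" "x \<in> P i" for i k x
  proof -
    have "i = 0 \<or> i = 1 \<or> i = 2 \<or> i = 3" using that by auto
    then show ?thesis
    proof (elim disjE)
      \<comment> \<open>A swap along a \<open>Red\<close> edge settles only \<open>Green\<close> and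
        \<open>Blue\<close>; the \<open>Red\<close> neighborhood needs the \<open>Green\<close> edge
        to \<open>w\<close>.\<close>
      assume i: "i = 0"
      then have x: "x \<in> nb Red u" "x \<in> nb Green w"
        using that P0 by (auto simp: P_def)
      show ?thesis
        using swap[OF x(1), of Green Blue] swap[OF x(1), of Blue Green] swap[OF x(2), of Red Blue]
          swap[OF mem(1), of Green Blue] swap[OF mem(1), of Blue Green] swap[OF mem(2), of Blue Red]
        by (cases k) (auto simp: i P_def partner_def)
    next
      assume i: "i = 1"
      then have x: "x \<in> nb Red v"
        using that by (auto simp: P_def)
      have "nb Green x = nb Blue v" "nb Blue x = nb Green v"
        using swap[OF x] by auto
      \<comment> \<open>\<open>s\<close> is now a \<open>Green\<close> neighbor of \<open>x\<close>,
        so a swap along \<open>xs\<close> supplies the missing color. The next two cases are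
        analogous.\<close>
      moreover from this have "nb Red x = nb Red u"
        using swap[of s Green x Blue Red] mem(3) P0 by auto
      ultimately show ?thesis
        by (cases k) (auto simp: i P_def partner_def)
    next
      assume i: "i = 2"
      then have x: "x \<in> nb Green v"
        using that by (auto simp: P_def)
      have "nb Red x = nb Blue v" "nb Blue x = nb Red v"
        using swap[OF x] by auto
      moreover from this have "nb Green x = nb Red u"
        using swap[of s Red x Blue Green] mem(3) P0 by auto
      ultimately show ?thesis
        by (cases k) (auto simp: i P_def partner_def)
    next
      assume i: "i = 3"
      then have x: "x \<in> nb Blue v"
        using that by (auto simp: P_def)
      have "nb Red x = nb Green v" "nb Green x = nb Red v"
        using swap[OF x] by auto
      moreover from this have "nb Blue x = nb Red u"
        using swap[of w Red x Green Blue] mem(2) P0 by auto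
      ultimately show ?thesis
        by (cases k) (auto simp: i P_def partner_def)
    qed
  qed
  moreover have "P i \<noteq> {}" if "i \<in> {..<4}" for i
  proof -
    have "i = 0 \<or> i = 1 \<or> i = 2 \<or> i = 3" using that by auto
    then show ?thesis
      using u w s sym mem by (elim disjE) (auto simp: P_def)
  qed
  ultimately show thesis using that by blast
qed

lemma blowup:
  "\<exists>V' I. V = V' \<union> I \<and> V' \<inter> I = {} \<and> (\<forall>v\<in>I. \<forall>e\<in>E. v \<notin> e) \<and> is_blowup_of_K4 V' E c"
proof -
  obtain P where ne: "\<And>x. x \<in> {..<4} \<Longrightarrow> P x \<noteq> {}"
    and nbP: "\<And>x k u. x \<in> {..<4} \<Longrightarrow> u \<in> P x \<Longrightarrow> nb k u = P (partner k x)"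
    using K4_parts by metis
  define V' where "V' = (\<Union>x\<in>{..<4}. P x)"
  have closed: "nb k u \<subseteq> V'" if "u \<in> V'" for k u
    using that nbP partner_less unfolding V'_def by fastforce
  \<comment> \<open>Uniqueness of the component: a \<open>Green\<close> edge at \<open>x\<close> and
    a \<open>Blue\<close> edge inside \<open>V'\<close> are linked by a \<open>Red\<close> edge,
    along which membership in \<open>V'\<close> spreads.\<close>
  have adj_V': "x \<in> V'" if adj: "adj k x y" for k x y
  proof -
    obtain q where q: "adj Green x q"
      using nb_nonempty[OF adj, of Green] by (auto simp: nb_def)
    obtain v where v: "v \<in> V'"
      using ne[of 0] unfolding V'_def by fastforce
    then obtain b where "b \<in> nb Blue v"
      using nbP ne partner_less unfolding V'_def by (metis UN_E ex_in_conv)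
    then have b: "adj Blue v b" "b \<in> V'"
      using closed[OF v] by (auto simp: nb_def)
    obtain x1 y1 z1 w1 where 1: "{x, q} = {x1, z1}" "{v, b} = {y1, w1}" "adj Red x1 y1" "adj Green x1 z1"
      using edges_linked[of Green Blue Red, OF _ q b(1)]
      by (metis distinct_length_2_or_more distinct_singleton color.distinct)
    have "y1 \<in> V'"
      using 1(2) v b(2) by (metis insertE insertI1 singletonD)
    then have x1: "x1 \<in> V'"
      using closed[of y1 Red] 1(3) by (auto simp: nb_def adj_sym)
    then have "z1 \<in> V'"
      using closed[of x1 Green] 1(4) by (auto simp: nb_def)
    then show ?thesis
      using x1 1(1) by (metis insertE insertI1 singletonD)
  qed
  have V'_sub: "V' \<subseteq> V"
  proof
    fix u assume "u \<in> V'"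
    then have "nb Red u \<noteq> {}"
      using nbP ne partner_less unfolding V'_def by (metis UN_E)
    then show "u \<in> V" by (auto simp: nb_def dest: adj_V)
  qed
  have isolated: "v \<notin> e" if "v \<in> V - V'" "e \<in> E" for v e
  proof
    assume "v \<in> e"
    then obtain y where "e = {v, y}"
      using \<open>e \<in> E\<close> by (metis edgeE insertE insert_commute singletonD)
    then show False
      using that adj_V'[of _ v y] by (auto simp: adj_def)
  qed
  have disj: "disjoint_family_on P {..<4}"
  proof (unfold disjoint_family_on_def, intro ballI impI)
    fix x y :: nat assume xy: "x \<in> {..<4}" "y \<in> {..<4}" "x \<noteq> y"
    show "P x \<inter> P y = {}"
    proof (rule ccontr)
      assume "P x \<inter> P y \<noteq> {}"
      then obtain u where u: "u \<in> P x" "u \<in> P y" by blast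
      \<comment> \<open>All of \<open>P y\<close> is adjacent to \<open>u\<close> as a vertex of
        \<open>P x\<close>, so \<open>u\<close> would be its own neighbor.\<close>
      have "u \<in> nb (K4_color {x, y}) u"
        using nbP[OF xy(1) u(1)] u(2) partner_K4_color[OF xy] by simp
      then show False by (simp add: nb_def adj_irrefl)
    qed
  qed
  have adjP: "adj (K4_color {x, y}) u v"
    if "x \<in> {..<4}" "y \<in> {..<4}" "x \<noteq> y" "u \<in> P x" "v \<in> P y" for x y u v
  proof -
    have "v \<in> nb (K4_color {x, y}) u"
      using nbP[OF that(1,4)] partner_K4_color[OF that(1-3)] that(5) by simp
    then show ?thesis by (simp add: nb_def)
  qed
  have "is_blowup V' E c {..<4} ([{..<4}]\<^bsup>2\<^esup>) K4_color"
    unfolding is_blowup_def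
  proof (intro exI conjI)
    show "E = {{u, v} | u v x y. x \<in> {..<4} \<and> y \<in> {..<4} \<and> {x, y} \<in> [{..<4}]\<^bsup>2\<^esup> \<and> u \<in> P x \<and> v \<in> P y}"
      (is "_ = ?S")
    proof (intro equalityI subsetI)
      fix e assume e: "e \<in> E"
      then obtain u v where uv: "e = {u, v}" by (metis edgeE)
      then have adj: "adj (c e) u v" using e by (simp add: adj_def)
      then obtain x where x: "x \<in> {..<4}" "u \<in> P x"
        using adj_V' unfolding V'_def by blast
      have "v \<in> P (partner (c e) x)"
        using nbP[OF x] adj by (auto simp: nb_def)
      moreover have "{x, partner (c e) x} \<in> [{..<4}]\<^bsup>2\<^esup>"
        using partner_less[OF x(1)] partner_neq[OF x(1), symmetric] x(1) by (simp add: nsets_def)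
      ultimately show "e \<in> ?S"
        unfolding mem_Collect_eq using x uv partner_less[OF x(1)] by metis
    next
      fix e assume "e \<in> ?S"
      then obtain u v x y where "e = {u, v}" "x \<in> {..<4}" "y \<in> {..<4}"
        "{x, y} \<in> [{..<4}]\<^bsup>2\<^esup>" "u \<in> P x" "v \<in> P y" by blast
      moreover from this have "x \<noteq> y" by (auto simp: nsets_def)
      ultimately show "e \<in> E" using adjP[of x y u v] by (auto simp: adj_def)
    qed
    show "\<forall>x\<in>{..<4}. \<forall>y\<in>{..<4}. {x, y} \<in> [{..<4}]\<^bsup>2\<^esup> \<longrightarrow>
        (\<forall>u\<in>P x. \<forall>v\<in>P y. c {u, v} = K4_color {x, y})"
    proof (intro ballI impI)
      fix x y u v
      assume "x \<in> {..<4}" "y \<in> {..<4}" "{x, y} \<in> [{..<4}]\<^bsup>2\<^esup>" "u \<in> P x" "v \<in> P y"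
      moreover from this have "x \<noteq> y" by (auto simp: nsets_def)
      ultimately show "c {u, v} = K4_color {x, y}" using adjP[of x y u v] by (auto simp: adj_def)
    qed
  qed (use ne disj V'_def in auto)
  then have "is_blowup_of_K4 V' E c"
    using properly_colored_K4 unfolding is_blowup_of_K4_def by blast
  moreover have "V = V' \<union> (V - V')" "V' \<inter> (V - V') = {}"
    using V'_sub by blast+
  moreover have "\<forall>v\<in>V - V'. \<forall>e\<in>E. v \<notin> e"
    using isolated by blast
  ultimately show ?thesis by blast
qed

end

theorem theorem1p2:
  fixes V :: "'a set" and E :: "'a set set" and c :: "'a set \<Rightarrow> color"
    and R G B :: nat
  assumes "finite_simple_graph V E"
    and "R = card (color_class E c Red)"
    and "G = card (color_class E c Green)"
    and "B = card (color_class E c Blue)"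
    and "real (card (rainbow_triangles V E c)) = sqrt (2 * real R * real G * real B)"
    and "sqrt (2 * real R * real G * real B) > 0"
  shows "\<exists>V' I. V = V' \<union> I \<and> V' \<inter> I = {} \<and> (\<forall>v\<in>I. \<forall>e\<in>E. v \<notin> e) \<and> is_blowup_of_K4 V' E c"
proof -
  \<comment> \<open>Squaring turns the hypothesis into the identity between natural numbers required
    by \<open>extremal\<close>.\<close>
  have "(real (card (rainbow_triangles V E c)))\<^sup>2 = 2 * real R * real G * real B"
    unfolding assms(5) by (rule real_sqrt_pow2) simp
  then have "real ((card (rainbow_triangles V E c))\<^sup>2) = real (2 * R * G * B)"
    by simp
  then have "(card (rainbow_triangles V E c))\<^sup>2 = 2 * R * G * B"
    by (simp only: of_nat_eq_iff)
  moreover have "rainbow_triangles V E c \<noteq> {}"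
    using assms(5,6) by auto
  ultimately interpret extremal_graph V E c
    using assms(1-4) by unfold_locales simp_all
  show ?thesis by (rule blowup)
qed

end
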